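(* Let $d\ge1$, $n\ge1$, and let $Q$ be a $d$-dimensional latin hypercube of order $n$. Then $Q$ contains exactly $n^{3d-1}$ cuboctahedra if and only if for every pair of directions $1\le i<j\le d$ there is a latin square $L^{i,j}$ of order $n$, isotopic to the Cayley table of some group, such that every $2$-dimensional plane of $Q$ of direction $(i,j)$ is principally isotopic to $L^{i,j}$.
   Context: A $d$-dimensional latin hypercube of order $n$ is an array $Q=(q_\alpha)$ indexed by $\alpha\in\{0,\ldots,n-1\}^d$ with entries in $\{0,\ldots,n-1\}$ such that any two indices differing in exactly one coordinate carry different symbols. A cuboctahedron in $Q$ is a tuple consisting of $d$ ordered pairs $(a^i_1,a^i_2)$ and $d$ ordered pairs $(b^i_1,b^i_2)$, $i=1,\ldots,d$, of elements of $\{0,\ldots,n-1\}$, such that $q_{a^1_{j_1},\ldots,a^d_{j_d}}=q_{b^1_{j_1},\ldots,b^d_{j_d}}$ for all $j_1,\ldots,j_d\in\{1,2\}$; cuboctahedra are counted as such tuples. A $2$-dimensional plane of direction $(i,j)$ is the $n\times n$ latin square obtained by letting coordinates $i$ and $j$ vary (rows indexed by coordinate $i$, columns by coordinate $j$) with all other coordinates fixed. Two latin squares are isotopic if one is obtained from the other by permuting rows, columns and symbols; principally isotopic if by permuting rows and columns only. A latin square is isotopic to the Cayley table of a group if it is isotopic to the multiplication table of a group of order $n$ with elements labelled $0,\ldots,n-1$. *)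

theory Defs
  imports "HOL-Library.FuncSet" "HOL-Combinatorics.Permutations" "HOL-Algebra.Group"
begin

(* Coordinates (directions) are numbered 0, ..., d - 1.  Indices are extensional functions, so
   that equality of indices and finite cardinalities have their usual meaning. *)

definition indices :: "nat \<Rightarrow> nat \<Rightarrow> (nat \<Rightarrow> nat) set" where
  "indices d n = {..<d} \<rightarrow>\<^sub>E {..<n}"

definition latin_hypercube :: "nat \<Rightarrow> nat \<Rightarrow> ((nat \<Rightarrow> nat) \<Rightarrow> nat) \<Rightarrow> bool" where
  "latin_hypercube d n Q \<longleftrightarrow>
     Q \<in> indices d n \<rightarrow> {..<n} \<and>
     (\<forall>\<alpha>\<in>indices d n. \<forall>\<beta>\<in>indices d n. (\<exists>!i. i < d \<and> \<alpha> i \<noteq> \<beta> i) \<longrightarrow> Q \<alpha> \<noteq> Q \<beta>)"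

definition pair_tuples :: "nat \<Rightarrow> nat \<Rightarrow> (nat \<Rightarrow> nat \<times> nat) set" where
  "pair_tuples d n = {..<d} \<rightarrow>\<^sub>E ({..<n} \<times> {..<n})"

(* A choice of j_1, ..., j_d in {1, 2} is encoded by a set J: coordinate i takes the second entry
   of its pair if i is in J, and the first entry otherwise. *)

definition corner :: "nat \<Rightarrow> (nat \<Rightarrow> nat \<times> nat) \<Rightarrow> nat set \<Rightarrow> (nat \<Rightarrow> nat)" where
  "corner d a J = (\<lambda>i\<in>{..<d}. if i \<in> J then snd (a i) else fst (a i))"

definition cuboctahedra ::
  "nat \<Rightarrow> nat \<Rightarrow> ((nat \<Rightarrow> nat) \<Rightarrow> nat) \<Rightarrow> ((nat \<Rightarrow> nat \<times> nat) \<times> (nat \<Rightarrow> nat \<times> nat)) set" where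
  "cuboctahedra d n Q =
     {(a, b). a \<in> pair_tuples d n \<and> b \<in> pair_tuples d n \<and>
              (\<forall>J\<subseteq>{..<d}. Q (corner d a J) = Q (corner d b J))}"

(* The fixed coordinates of the plane are those of the index \<alpha> other than i and j;
   the values of \<alpha> at i and j are irrelevant. *)

definition plane :: "((nat \<Rightarrow> nat) \<Rightarrow> nat) \<Rightarrow> (nat \<Rightarrow> nat) \<Rightarrow> nat \<Rightarrow> nat \<Rightarrow> (nat \<Rightarrow> nat \<Rightarrow> nat)" where
  "plane Q \<alpha> i j = (\<lambda>r c. Q (\<alpha>(i := r, j := c)))"

(* Only the values of a square at r, c < n matter. *)

definition latin_square :: "nat \<Rightarrow> (nat \<Rightarrow> nat \<Rightarrow> nat) \<Rightarrow> bool" where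
  "latin_square n L \<longleftrightarrow>
     (\<forall>r<n. \<forall>c<n. L r c < n) \<and>
     (\<forall>r<n. inj_on (\<lambda>c. L r c) {..<n}) \<and>
     (\<forall>c<n. inj_on (\<lambda>r. L r c) {..<n})"

definition isotopic :: "nat \<Rightarrow> (nat \<Rightarrow> nat \<Rightarrow> nat) \<Rightarrow> (nat \<Rightarrow> nat \<Rightarrow> nat) \<Rightarrow> bool" where
  "isotopic n L M \<longleftrightarrow>
     (\<exists>\<rho> \<sigma> \<tau>. \<rho> permutes {..<n} \<and> \<sigma> permutes {..<n} \<and> \<tau> permutes {..<n} \<and>
       (\<forall>r<n. \<forall>c<n. L r c = \<tau> (M (\<rho> r) (\<sigma> c))))"

definition principally_isotopic :: "nat \<Rightarrow> (nat \<Rightarrow> nat \<Rightarrow> nat) \<Rightarrow> (nat \<Rightarrow> nat \<Rightarrow> nat) \<Rightarrow> bool" where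
  "principally_isotopic n L M \<longleftrightarrow>
     (\<exists>\<rho> \<sigma>. \<rho> permutes {..<n} \<and> \<sigma> permutes {..<n} \<and>
       (\<forall>r<n. \<forall>c<n. L r c = M (\<rho> r) (\<sigma> c)))"

definition isotopic_to_Cayley_table :: "nat \<Rightarrow> (nat \<Rightarrow> nat \<Rightarrow> nat) \<Rightarrow> bool" where
  "isotopic_to_Cayley_table n L \<longleftrightarrow>
     (\<exists>G :: nat monoid. group G \<and> carrier G = {..<n} \<and> isotopic n L (\<lambda>x y. x \<otimes>\<^bsub>G\<^esub> y))"

end

theory Submission
  imports Defs
begin

text \<open>A cuboctahedron \<open>(a, b)\<close> is determined by \<open>a\<close> and the first entries of the pairs in \<open>b\<close>:
  the corners in which exactly one second entry is chosen then fix the second entries in \<open>b\<close>. This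
  gives the upper bound \<open>n\<^sup>2\<^sup>d n\<^sup>d\<^sup>-\<^sup>1\<close>, with equality iff agreement of the \<open>d + 1\<close> corners with
  at most one second entry always forces agreement of all corners. On two planes of a common
  direction this is Frolov's quadrangle criterion across the two squares, which makes the squares
  principally isotopic to each other and to the table of a group. Conversely, group tables satisfy the
  quadrangle criterion, and it propagates agreement to all corners by induction on the number of
  second entries chosen.\<close>

section \<open>Latin squares: from the quadrangle criterion to groups\<close>

text \<open>For \<open>L = M\<close> this is the classical quadrangle criterion. Two squares are
  allowed so that different planes of one direction can be compared symbol by symbol.\<close>

definition quadrangle :: "nat \<Rightarrow> (nat \<Rightarrow> nat \<Rightarrow> nat) \<Rightarrow> (nat \<Rightarrow> nat \<Rightarrow> nat) \<Rightarrow> bool" where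
  "quadrangle n L M \<longleftrightarrow>
     (\<forall>r<n. \<forall>c<n. \<forall>s<n. \<forall>t<n. \<forall>r'<n. \<forall>c'<n. \<forall>s'<n. \<forall>t'<n.
        L r c = M r' c' \<longrightarrow> L s c = M s' c' \<longrightarrow> L r t = M r' t' \<longrightarrow> L s t = M s' t')"

lemma quadrangleD:
  assumes "quadrangle n L M" "L r c = M r' c'" "L s c = M s' c'" "L r t = M r' t'"
    and "r < n" "c < n" "s < n" "t < n" "r' < n" "c' < n" "s' < n" "t' < n"
  shows "L s t = M s' t'"
  by (rule assms(1)[unfolded quadrangle_def, rule_format, OF assms(5-12,2-4)])

lemma inj_on_lessThan_bij_betw:
  fixes f :: "nat \<Rightarrow> nat"
  assumes "inj_on f {..<n}" "\<And>x. x < n \<Longrightarrow> f x < n"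
  shows "bij_betw f {..<n} {..<n}"
proof -
  have "f ` {..<n} \<subseteq> {..<n}" using assms(2) by auto
  then have "f ` {..<n} = {..<n}" using endo_inj_surj[OF _ _ assms(1)] by simp
  then show ?thesis using assms(1) by (simp add: bij_betw_def)
qed

lemma bij_betw_extend_permutes:
  assumes "bij_betw f A A"
  shows "(\<lambda>x. if x \<in> A then f x else x) permutes A"
proof (rule bij_imp_permutes)
  show "bij_betw (\<lambda>x. if x \<in> A then f x else x) A A"
    using assms by (simp cong: bij_betw_cong)
qed simp

lemma latin_square_less:
  "latin_square n L \<Longrightarrow> r < n \<Longrightarrow> c < n \<Longrightarrow> L r c < n"
  by (simp add: latin_square_def)

lemma latin_square_row_bij:
  assumes "latin_square n L" "r < n"
  shows "bij_betw (\<lambda>c. L r c) {..<n} {..<n}"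
  using assms by (intro inj_on_lessThan_bij_betw) (auto simp: latin_square_def)

lemma latin_square_column_bij:
  assumes "latin_square n L" "c < n"
  shows "bij_betw (\<lambda>r. L r c) {..<n} {..<n}"
  using assms by (intro inj_on_lessThan_bij_betw) (auto simp: latin_square_def)

lemma bij_betw_lessThan_preimage:
  fixes f :: "nat \<Rightarrow> nat"
  assumes "bij_betw f {..<n} {..<n}" "y < n"
  obtains x where "x < n" "f x = y"
  using assms by (metis bij_betw_imp_surj_on imageE lessThan_iff)

text \<open>Column 0 of \<open>L\<close> is matched with column 0 of \<open>M\<close>, which pairs
  the rows; row 0 of \<open>L\<close> is matched with the row \<open>r0\<close> of \<open>M\<close>
  that has the same entry in column 0, which pairs the columns. Every further entry is the fourth
  corner of a quadrangle whose other three corners lie on these matched lines.\<close>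

lemma quadrangle_imp_principally_isotopic:
  assumes L: "latin_square n L" and M: "latin_square n M" and n: "0 < n"
    and q: "quadrangle n L M"
  shows "principally_isotopic n L M"
proof -
  obtain r0 where r0: "r0 < n" "M r0 0 = L 0 0"
    using bij_betw_lessThan_preimage[OF latin_square_column_bij[OF M n] latin_square_less[OF L n n]] .
  define f where "f = the_inv_into {..<n} (\<lambda>r. M r 0) \<circ> (\<lambda>r. L r 0)"
  define g where "g = the_inv_into {..<n} (\<lambda>c. M r0 c) \<circ> (\<lambda>c. L 0 c)"
  have f: "bij_betw f {..<n} {..<n}" unfolding f_def
    by (rule bij_betw_trans[OF latin_square_column_bij[OF L n]
          bij_betw_the_inv_into[OF latin_square_column_bij[OF M n]]])
  have g: "bij_betw g {..<n} {..<n}" unfolding g_def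
    by (rule bij_betw_trans[OF latin_square_row_bij[OF L n]
          bij_betw_the_inv_into[OF latin_square_row_bij[OF M r0(1)]]])
  have fM: "M (f r) 0 = L r 0" if "r < n" for r
    using f_the_inv_into_f_bij_betw[OF latin_square_column_bij[OF M n]]
      latin_square_less[OF L that n] by (simp add: f_def)
  have gM: "M r0 (g c) = L 0 c" if "c < n" for c
    using f_the_inv_into_f_bij_betw[OF latin_square_row_bij[OF M r0(1)]]
      latin_square_less[OF L n that] by (simp add: g_def)
  have less: "f x < n" "g x < n" if "x < n" for x
    using that f g by (auto dest: bij_betwE)
  have "L r c = M (f r) (g c)" if "r < n" "c < n" for r c
    by (rule quadrangleD[OF q, of 0 0 r0 0])
      (simp_all add: that n r0 fM gM less)
  then have eq: "\<forall>r<n. \<forall>c<n. L r c =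
      M ((\<lambda>x. if x \<in> {..<n} then f x else x) r) ((\<lambda>x. if x \<in> {..<n} then g x else x) c)"
    by simp
  show ?thesis unfolding principally_isotopic_def
    using eq bij_betw_extend_permutes[OF f] bij_betw_extend_permutes[OF g] by blast
qed

text \<open>Naming each row by its entry in column 0 and each column by its entry in row 0 turns
  \<open>L\<close> into the table of a loop \<open>m\<close> with unit \<open>L 0 0\<close>. The
  quadrangle criterion makes this loop associative, hence a group.\<close>

lemma quadrangle_imp_isotopic_to_Cayley_table:
  assumes L: "latin_square n L" and n: "0 < n" and q: "quadrangle n L L"
  shows "isotopic_to_Cayley_table n L"
proof -
  define row where "row = the_inv_into {..<n} (\<lambda>r. L r 0)"
  define col where "col = the_inv_into {..<n} (\<lambda>c. L 0 c)"
  define m where "m x y = L (row x) (col y)" for x y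
  note R = latin_square_column_bij[OF L n] and C = latin_square_row_bij[OF L n]
  have row: "row x < n" "L (row x) 0 = x" if "x < n" for x
    using that f_the_inv_into_f_bij_betw[OF R] bij_betwE[OF bij_betw_the_inv_into[OF R]]
    by (auto simp: row_def)
  have col: "col x < n" "L 0 (col x) = x" if "x < n" for x
    using that f_the_inv_into_f_bij_betw[OF C] bij_betwE[OF bij_betw_the_inv_into[OF C]]
    by (auto simp: col_def)
  have row_L: "row (L r 0) = r" if "r < n" for r
    using that R the_inv_into_f_f[of "\<lambda>r. L r 0"] by (auto simp: row_def bij_betw_def)
  have col_L: "col (L 0 c) = c" if "c < n" for c
    using that C the_inv_into_f_f[of "\<lambda>c. L 0 c"] by (auto simp: col_def bij_betw_def)
  define e where "e = L 0 0"
  have e: "e < n" "row e = 0" "col e = 0"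
    using latin_square_less[OF L n n] row_L[OF n] col_L[OF n] by (auto simp: e_def)
  have less: "m x y < n" if "x < n" "y < n" for x y
    using that latin_square_less[OF L] row col by (simp add: m_def)
  have unit: "m e x = x" "m x e = x" if "x < n" for x
    using that row col e by (auto simp: m_def)
  have assoc: "m (m x y) z = m x (m y z)" if "x < n" "y < n" "z < n" for x y z
  proof -
    \<comment> \<open>Compare the rows \<open>y, xy\<close> and columns \<open>e, z\<close> with the rows \<open>e, x\<close> and columns \<open>y, yz\<close>.\<close>
    have "L (row (m x y)) (col z) = L (row x) (col (m y z))"
    proof (rule quadrangleD[OF q])
      show "L (row y) (col e) = L (row e) (col y)"
        using unit[OF that(2)] by (simp add: m_def)
      show "L (row (m x y)) (col e) = L (row x) (col y)"
        using unit(2)[OF less[OF that(1,2)]] by (simp add: m_def)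
      show "L (row y) (col z) = L (row e) (col (m y z))"
        using unit(1)[OF less[OF that(2,3)]] by (simp add: m_def)
    qed (simp_all add: that e less row col n)
    then show ?thesis by (simp add: m_def)
  qed
  define G where "G = \<lparr>carrier = {..<n}, mult = m, one = e\<rparr>"
  have "group G"
  proof (rule groupI)
    \<comment> \<open>Left inverses suffice for \<open>groupI\<close>. The inverse of
      \<open>x\<close> is the name of the row in which the column named \<open>x\<close> carries the
      unit.\<close>
    fix x assume x: "x \<in> carrier G"
    have "col x < n" using x col by (simp add: G_def)
    then obtain r where r: "r < n" "L r (col x) = e"
      using bij_betw_lessThan_preimage[OF latin_square_column_bij[OF L] e(1)] by blast
    have "m (L r 0) x = e" using r row_L by (simp add: m_def)
    then show "\<exists>y\<in>carrier G. y \<otimes>\<^bsub>G\<^esub> x = \<one>\<^bsub>G\<^esub>"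
      using latin_square_less[OF L r(1) n] by (auto simp: G_def)
  qed (auto simp: G_def less unit e assoc)
  moreover have "isotopic n L (\<lambda>x y. x \<otimes>\<^bsub>G\<^esub> y)"
  proof -
    \<comment> \<open>Rows and columns go to their names, extended by the identity beyond
      \<open>n\<close> because \<open>permutes\<close> demands it. Symbols stay as they are, so the
      symbol permutation is \<open>id\<close>.\<close>
    have "\<forall>r<n. \<forall>c<n. L r c = id (m ((\<lambda>x. if x \<in> {..<n} then L x 0 else x) r)
        ((\<lambda>x. if x \<in> {..<n} then L 0 x else x) c))"
      by (simp add: m_def row_L col_L)
    then show ?thesis unfolding isotopic_def G_def monoid.simps
      using bij_betw_extend_permutes[OF R] bij_betw_extend_permutes[OF C] permutes_id by blast
  qed
  ultimately show ?thesis
    unfolding isotopic_to_Cayley_table_def by (intro exI[of _ G]) (simp add: G_def)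
qed

section \<open>From groups back to the quadrangle criterion\<close>

text \<open>Three corners of a quadrangle in a group table determine the fourth, since
  \<open>uv\<close> is the product of \<open>uy\<close>, the inverse of \<open>xy\<close>, and
  \<open>xv\<close>.\<close>

lemma (in group) quadrangle_mult:
  assumes "x \<otimes> y = x' \<otimes> y'" "u \<otimes> y = u' \<otimes> y'" "x \<otimes> v = x' \<otimes> v'"
    and "x \<in> carrier G" "y \<in> carrier G" "u \<in> carrier G" "v \<in> carrier G"
    and "x' \<in> carrier G" "y' \<in> carrier G" "u' \<in> carrier G" "v' \<in> carrier G"
  shows "u \<otimes> v = u' \<otimes> v'"
proof -
  have eq: "a \<otimes> d = (a \<otimes> b) \<otimes> inv (c \<otimes> b) \<otimes> (c \<otimes> d)"
    if "a \<in> carrier G" "b \<in> carrier G" "c \<in> carrier G" "d \<in> carrier G" for a b c d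
  proof -
    have "(a \<otimes> b) \<otimes> inv (c \<otimes> b) \<otimes> (c \<otimes> d) = a \<otimes> (b \<otimes> (inv b \<otimes> (inv c \<otimes> (c \<otimes> d))))"
      using that by (simp add: inv_mult_group m_assoc)
    also have "\<dots> = a \<otimes> d"
      using that by (simp add: m_assoc[symmetric])
    finally show ?thesis by simp
  qed
  show ?thesis
    using eq[of u y x v] eq[of u' y' x' v'] assms by simp
qed

text \<open>Isotopy respects the criterion: \<rho> and \<sigma> merely rename rows and columns, and
  the injective \<tau> cancels from every equation between entries.\<close>

lemma isotopic_to_Cayley_table_imp_quadrangle:
  assumes "isotopic_to_Cayley_table n L"
  shows "quadrangle n L L"
proof -
  obtain G :: "nat monoid" and \<rho> \<sigma> \<tau> where G: "group G" "carrier G = {..<n}"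
    and p: "\<rho> permutes {..<n}" "\<sigma> permutes {..<n}" "\<tau> permutes {..<n}"
    and L: "\<And>r c. r < n \<Longrightarrow> c < n \<Longrightarrow> L r c = \<tau> (\<rho> r \<otimes>\<^bsub>G\<^esub> \<sigma> c)"
    using assms unfolding isotopic_to_Cayley_table_def isotopic_def by metis
  have \<tau>: "\<tau> x = \<tau> y \<longleftrightarrow> x = y" for x y
    using permutes_inj[OF p(3)] by (simp add: inj_eq)
  have mem: "\<rho> x \<in> carrier G" "\<sigma> x \<in> carrier G" if "x < n" for x
    using that permutes_in_image[OF p(1)] permutes_in_image[OF p(2)] by (auto simp: G(2))
  show ?thesis
    unfolding quadrangle_def
  proof (intro allI impI)
    fix r c s t r' c' s' t'
    assume less: "r < n" "c < n" "s < n" "t < n" "r' < n" "c' < n" "s' < n" "t' < n"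
      and eq: "L r c = L r' c'" "L s c = L s' c'" "L r t = L r' t'"
    have "\<rho> s \<otimes>\<^bsub>G\<^esub> \<sigma> t = \<rho> s' \<otimes>\<^bsub>G\<^esub> \<sigma> t'"
      by (rule group.quadrangle_mult[OF G(1)]) (use eq less in \<open>auto simp: L \<tau> mem\<close>)
    then show "L s t = L s' t'" using less by (simp add: L)
  qed
qed

text \<open>Here it matters that the isotopies are principal: symbols are untouched, so an equation
  between an entry of \<open>P\<close> and one of \<open>P'\<close> becomes an equation between two
  entries of the common square \<open>L\<close>.\<close>

lemma quadrangle_principally_isotopic:
  assumes q: "quadrangle n L L"
    and "principally_isotopic n P L" "principally_isotopic n P' L"
  shows "quadrangle n P P'"
proof -
  obtain \<rho> \<sigma> \<rho>' \<sigma>' where p: "\<rho> permutes {..<n}" "\<sigma> permutes {..<n}"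
      "\<rho>' permutes {..<n}" "\<sigma>' permutes {..<n}"
    and P: "\<And>r c. r < n \<Longrightarrow> c < n \<Longrightarrow> P r c = L (\<rho> r) (\<sigma> c)"
    and P': "\<And>r c. r < n \<Longrightarrow> c < n \<Longrightarrow> P' r c = L (\<rho>' r) (\<sigma>' c)"
    using assms(2,3) unfolding principally_isotopic_def by metis
  have mem: "\<rho> x < n" "\<sigma> x < n" "\<rho>' x < n" "\<sigma>' x < n" if "x < n" for x
    using that p[THEN permutes_in_image, of x] by auto
  show ?thesis
    unfolding quadrangle_def
  proof (intro allI impI)
    fix r c s t r' c' s' t'
    assume less: "r < n" "c < n" "s < n" "t < n" "r' < n" "c' < n" "s' < n" "t' < n"
      and eq: "P r c = P' r' c'" "P s c = P' s' c'" "P r t = P' r' t'"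
    have "L (\<rho> s) (\<sigma> t) = L (\<rho>' s') (\<sigma>' t')"
      by (rule quadrangleD[OF q, of "\<rho> r" "\<sigma> c" "\<rho>' r'" "\<sigma>' c'"])
        (use eq less in \<open>auto simp: P P' mem\<close>)
    then show "P s t = P' s' t'" using less by (simp add: P P')
  qed
qed

section \<open>Lines, planes and corners in a latin hypercube\<close>

lemma indices_upd:
  "\<alpha> \<in> indices d n \<Longrightarrow> i < d \<Longrightarrow> x < n \<Longrightarrow> \<alpha>(i := x) \<in> indices d n"
  by (auto simp: indices_def PiE_iff extensional_def)

lemma indices_less: "\<alpha> \<in> indices d n \<Longrightarrow> i < d \<Longrightarrow> \<alpha> i < n"
  by (auto simp: indices_def)

lemma latin_hypercube_less:
  "latin_hypercube d n Q \<Longrightarrow> \<alpha> \<in> indices d n \<Longrightarrow> Q \<alpha> < n"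
  by (auto simp: latin_hypercube_def)

lemma latin_hypercube_line_bij:
  assumes "latin_hypercube d n Q" "\<alpha> \<in> indices d n" "i < d"
  shows "bij_betw (\<lambda>x. Q (\<alpha>(i := x))) {..<n} {..<n}"
proof (rule inj_on_lessThan_bij_betw)
  show "inj_on (\<lambda>x. Q (\<alpha>(i := x))) {..<n}"
  proof (rule inj_onI, rule ccontr)
    fix x y assume *: "x \<in> {..<n}" "y \<in> {..<n}" "Q (\<alpha>(i := x)) = Q (\<alpha>(i := y))" "x \<noteq> y"
    then have "\<exists>!k. k < d \<and> (\<alpha>(i := x)) k \<noteq> (\<alpha>(i := y)) k"
      using assms(3) by (intro ex1I[of _ i]) (auto split: if_splits)
    then show False
      using * assms indices_upd unfolding latin_hypercube_def by (metis lessThan_iff)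
  qed
qed (intro latin_hypercube_less[OF assms(1)] indices_upd assms(2,3))

lemma latin_hypercube_line_eq:
  assumes "latin_hypercube d n Q" "\<alpha> \<in> indices d n" "i < d" "x < n" "y < n"
    and "Q (\<alpha>(i := x)) = Q (\<alpha>(i := y))"
  shows "x = y"
  using latin_hypercube_line_bij[OF assms(1-3)] assms(4-) by (auto simp: bij_betw_def inj_on_def)

lemma latin_square_plane:
  assumes Q: "latin_hypercube d n Q" and \<alpha>: "\<alpha> \<in> indices d n" and ij: "i < j" "j < d"
  shows "latin_square n (plane Q \<alpha> i j)"
  unfolding latin_square_def plane_def
proof (intro conjI allI impI)
  have i: "i < d" using ij by simp
  fix r assume r: "r < n"
  show "inj_on (\<lambda>c. Q (\<alpha>(i := r, j := c))) {..<n}"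
    using latin_hypercube_line_bij[OF Q indices_upd[OF \<alpha> i r] ij(2)] by (simp add: bij_betw_def)
  \<comment> \<open>In this goal the fixed \<open>r\<close> is the column number and
    \<open>r'\<close> runs through the rows.\<close>
  show "inj_on (\<lambda>r'. Q (\<alpha>(i := r', j := r))) {..<n}"
    using latin_hypercube_line_bij[OF Q indices_upd[OF \<alpha> ij(2) r] i] ij
    by (simp add: bij_betw_def fun_upd_twist[of i j])
  fix c assume "c < n"
  then show "Q (\<alpha>(i := r, j := c)) < n"
    using latin_hypercube_less[OF Q] indices_upd \<alpha> i ij r by blast
qed

lemma corner_in_indices: "a \<in> pair_tuples d n \<Longrightarrow> corner d a J \<in> indices d n"
  by (fastforce simp: corner_def indices_def pair_tuples_def PiE_iff mem_Times_iff)

lemma corner_insert: "i < d \<Longrightarrow> corner d a (insert i J) = (corner d a J)(i := snd (a i))"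
  by (auto simp: corner_def fun_eq_iff)

lemma pair_tuples_less:
  "a \<in> pair_tuples d n \<Longrightarrow> i < d \<Longrightarrow> fst (a i) < n"
  "a \<in> pair_tuples d n \<Longrightarrow> i < d \<Longrightarrow> snd (a i) < n"
  by (auto simp: pair_tuples_def PiE_iff mem_Times_iff)

section \<open>Counting cuboctahedra\<close>

text \<open>Every line in direction 0 contains the symbol \<open>s\<close> exactly once, so the
  other \<open>d - 1\<close> coordinates can be chosen freely and determine coordinate 0.\<close>

lemma card_latin_hypercube_fibre:
  assumes Q: "latin_hypercube d n Q" and d: "d \<ge> 1" and s: "s < n"
  shows "card {\<beta> \<in> indices d n. Q \<beta> = s} = n ^ (d - 1)"
proof -
  let ?F = "{\<beta> \<in> indices d n. Q \<beta> = s}" and ?T = "{1..<d} \<rightarrow>\<^sub>E {..<n}"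
  have "bij_betw (\<lambda>\<beta>. restrict \<beta> {1..<d}) ?F ?T"
  proof (rule bij_betw_imageI)
    show "inj_on (\<lambda>\<beta>. restrict \<beta> {1..<d}) ?F"
    proof (rule inj_onI)
      fix \<beta> \<gamma> assume *: "\<beta> \<in> ?F" "\<gamma> \<in> ?F" "restrict \<beta> {1..<d} = restrict \<gamma> {1..<d}"
      \<comment> \<open>Both indices are \<open>undefined\<close> outside \<open>{..<d}\<close>, so
        agreement on \<open>{1..<d}\<close> leaves only coordinate 0 open.\<close>
      have upd: "\<gamma> = \<beta>(0 := \<gamma> 0)"
      proof
        fix k
        consider "k = 0" | "k \<in> {1..<d}" | "k \<notin> {..<d}" using d by fastforce
        then show "\<gamma> k = (\<beta>(0 := \<gamma> 0)) k"
        proof cases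
          case 2 then show ?thesis using fun_cong[OF *(3), of k] by simp
        next
          case 3 then show ?thesis using *(1,2) d by (auto simp: indices_def PiE_iff extensional_def)
        qed simp
      qed
      moreover have "\<beta> 0 = \<gamma> 0"
        by (rule latin_hypercube_line_eq[OF Q, of \<beta> 0])
          (use * d upd indices_less[of _ d n 0] in auto)
      ultimately show "\<beta> = \<gamma>" by (metis fun_upd_triv)
    qed
    show "(\<lambda>\<beta>. restrict \<beta> {1..<d}) ` ?F = ?T"
    proof
      show "(\<lambda>\<beta>. restrict \<beta> {1..<d}) ` ?F \<subseteq> ?T"
        by (rule image_subsetI) (simp add: indices_def PiE_iff)
      show "?T \<subseteq> (\<lambda>\<beta>. restrict \<beta> {1..<d}) ` ?F"
      proof
        fix \<gamma> assume \<gamma>: "\<gamma> \<in> ?T"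
        \<comment> \<open>The value \<open>s\<close> at 0 is a placeholder that makes \<gamma> an
          index; it is overwritten when the line in direction 0 is searched for the symbol
          \<open>s\<close>.\<close>
        then have "\<gamma>(0 := s) \<in> indices d n"
          using s d by (auto simp: indices_def PiE_iff extensional_def)
        then have "bij_betw (\<lambda>x. Q ((\<gamma>(0 := s))(0 := x))) {..<n} {..<n}"
          using d by (intro latin_hypercube_line_bij[OF Q]) simp_all
        then obtain x where x: "x < n" "Q ((\<gamma>(0 := s))(0 := x)) = s"
          using s by (rule bij_betw_lessThan_preimage)
        have "\<gamma>(0 := x) \<in> ?F"
          using x \<gamma> d by (auto simp: indices_def PiE_iff extensional_def)
        moreover have "restrict (\<gamma>(0 := x)) {1..<d} = \<gamma>"
          using \<gamma> by (auto simp: fun_eq_iff restrict_def PiE_iff extensional_def)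
        ultimately show "\<gamma> \<in> (\<lambda>\<beta>. restrict \<beta> {1..<d}) ` ?F"
          by (metis (no_types, lifting) rev_image_eqI)
      qed
    qed
  qed
  then have "card ?F = card ?T" by (rule bij_betw_same_card)
  then show ?thesis by (simp add: card_PiE)
qed

text \<open>The corners form the vertices of a \<open>d\<close>-cube. Those compared here are the
  base vertex and its \<open>d\<close> neighbours, which span a simplex.\<close>

definition simplex_agreement ::
  "nat \<Rightarrow> ((nat \<Rightarrow> nat) \<Rightarrow> nat) \<Rightarrow> (nat \<Rightarrow> nat \<times> nat) \<Rightarrow> (nat \<Rightarrow> nat \<times> nat) \<Rightarrow> bool" where
  "simplex_agreement d Q a b \<longleftrightarrow> Q (corner d a {}) = Q (corner d b {}) \<and>
     (\<forall>i<d. Q (corner d a {i}) = Q (corner d b {i}))"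

lemma cuboctahedra_simplex_agreement:
  "(a, b) \<in> cuboctahedra d n Q \<Longrightarrow> simplex_agreement d Q a b"
  by (auto simp: cuboctahedra_def simplex_agreement_def)

text \<open>Once the first entries are fixed, the second entry in direction \<open>i\<close> is
  located by its symbol on the line in direction \<open>i\<close> through the base corner, where
  symbols do not repeat.\<close>

lemma simplex_agreement_unique:
  assumes Q: "latin_hypercube d n Q" and b: "b \<in> pair_tuples d n" and c: "c \<in> pair_tuples d n"
    and "simplex_agreement d Q a b" "simplex_agreement d Q a c"
    and eq: "corner d b {} = corner d c {}"
  shows "b = c"
proof (rule PiE_ext[OF b[unfolded pair_tuples_def] c[unfolded pair_tuples_def]])
  fix i assume "i \<in> {..<d}"
  then have i: "i < d" by simp
  have "Q (corner d b {i}) = Q (corner d c {i})"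
    using assms(4,5) i by (simp add: simplex_agreement_def)
  then have "snd (b i) = snd (c i)"
    using latin_hypercube_line_eq[OF Q corner_in_indices[OF b] i] pair_tuples_less b c i
    by (metis corner_insert eq)
  moreover have "fst (b i) = fst (c i)"
    using fun_cong[OF eq, of i] i by (simp add: corner_def)
  ultimately show "b i = c i" by (simp add: prod_eq_iff)
qed

text \<open>The second entries can be found independently, one direction at a time, because the line
  through \<beta> in each direction contains every symbol.\<close>

lemma simplex_agreement_exists:
  assumes Q: "latin_hypercube d n Q" and a: "a \<in> pair_tuples d n" and \<beta>: "\<beta> \<in> indices d n"
    and eq: "Q \<beta> = Q (corner d a {})"
  obtains b where "b \<in> pair_tuples d n" "corner d b {} = \<beta>" "simplex_agreement d Q a b"
proof -
  have "\<exists>y<n. Q (\<beta>(i := y)) = Q (corner d a {i})" if "i < d" for i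
    using bij_betw_lessThan_preimage[OF latin_hypercube_line_bij[OF Q \<beta> that]
        latin_hypercube_less[OF Q corner_in_indices[OF a]]] by metis
  then obtain y where y: "\<And>i. i < d \<Longrightarrow> y i < n"
    "\<And>i. i < d \<Longrightarrow> Q (\<beta>(i := y i)) = Q (corner d a {i})" by metis
  define b where "b = (\<lambda>i\<in>{..<d}. (\<beta> i, y i))"
  have b: "b \<in> pair_tuples d n"
    using y(1) indices_less[OF \<beta>] by (auto simp: b_def pair_tuples_def)
  have c: "corner d b {} = \<beta>"
    using \<beta> by (auto simp: corner_def b_def fun_eq_iff indices_def PiE_iff extensional_def)
  have "simplex_agreement d Q a b"
    using y(2) eq c by (auto simp: simplex_agreement_def corner_insert b_def)
  with b c show thesis by (rule that)
qed

text \<open>Keeping \<open>a\<close> and only the base corner of \<open>b\<close> embeds the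
  cuboctahedra into the finite set \<open>T\<close>, whose size is the number in question. Equality
  therefore means surjectivity. Each point of \<open>T\<close> comes from exactly one pair with
  simplex agreement, so surjectivity says that all these pairs are cuboctahedra.\<close>

lemma card_cuboctahedra_eq_iff:
  assumes Q: "latin_hypercube d n Q" and d: "d \<ge> 1"
  shows "card (cuboctahedra d n Q) = n ^ (3 * d - 1) \<longleftrightarrow>
    (\<forall>a\<in>pair_tuples d n. \<forall>b\<in>pair_tuples d n.
       simplex_agreement d Q a b \<longrightarrow> (a, b) \<in> cuboctahedra d n Q)"
    (is "_ \<longleftrightarrow> ?complete")
proof -
  let ?C = "cuboctahedra d n Q"
  define T where "T = (SIGMA a:pair_tuples d n. {\<beta> \<in> indices d n. Q \<beta> = Q (corner d a {})})"
  define f where "f = (\<lambda>(a, b). (a :: nat \<Rightarrow> nat \<times> nat, corner d b {}))"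
  have finP: "finite (pair_tuples d n)" by (simp add: pair_tuples_def finite_PiE)
  have finI: "finite (indices d n)" by (simp add: indices_def finite_PiE)
  have finT: "finite T" using finP finI by (simp add: T_def)
  have cardP: "card (pair_tuples d n) = n ^ (2 * d)"
    by (simp add: pair_tuples_def card_PiE power_mult power2_eq_square)
  have "card T = (\<Sum>a\<in>pair_tuples d n. card {\<beta> \<in> indices d n. Q \<beta> = Q (corner d a {})})"
    unfolding T_def using finP finI by (intro card_SigmaI) auto
  also have "\<dots> = (\<Sum>a\<in>pair_tuples d n. n ^ (d - 1))"
    by (intro sum.cong refl card_latin_hypercube_fibre[OF Q d] latin_hypercube_less[OF Q]
        corner_in_indices)
  also have "\<dots> = n ^ (2 * d + (d - 1))" by (simp add: cardP power_add)
  also have "2 * d + (d - 1) = 3 * d - 1" using d by simp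
  finally have cardT: "card T = n ^ (3 * d - 1)" .
  have inj: "inj_on f ?C"
  proof (rule inj_onI)
    fix p q assume pq: "p \<in> ?C" "q \<in> ?C" "f p = f q"
    obtain a b where p: "p = (a, b)" by fastforce
    obtain c where q: "q = (a, c)" using pq(3) by (cases q) (auto simp: f_def p)
    have "b = c"
      using pq simplex_agreement_unique[OF Q, of b c a] cuboctahedra_simplex_agreement
      by (auto simp: p q f_def cuboctahedra_def)
    then show "p = q" by (simp add: p q)
  qed
  have sub: "f ` ?C \<subseteq> T"
  proof
    fix x assume "x \<in> f ` ?C"
    then obtain a b where ab: "(a, b) \<in> ?C" "x = (a, corner d b {})" by (auto simp: f_def)
    then have "Q (corner d b {}) = Q (corner d a {})"
      using cuboctahedra_simplex_agreement[OF ab(1)] by (simp add: simplex_agreement_def)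
    then show "x \<in> T" using ab corner_in_indices by (auto simp: T_def cuboctahedra_def)
  qed
  have "card ?C = card T \<longleftrightarrow> f ` ?C = T"
    using card_image[OF inj] card_subset_eq[OF finT sub] by auto
  also have "\<dots> \<longleftrightarrow> ?complete"
  proof
    assume eq: "f ` ?C = T"
    show ?complete
    proof (intro ballI impI)
      fix a b assume a: "a \<in> pair_tuples d n" and b: "b \<in> pair_tuples d n"
        and ab: "simplex_agreement d Q a b"
      then have "(a, corner d b {}) \<in> T"
        using corner_in_indices by (simp add: T_def simplex_agreement_def)
      then obtain c where c: "(a, c) \<in> ?C" "corner d b {} = corner d c {}"
        unfolding eq[symmetric] f_def by auto
      have "b = c"
        using simplex_agreement_unique[OF Q b _ ab cuboctahedra_simplex_agreement[OF c(1)] c(2)]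
          c(1) by (simp add: cuboctahedra_def)
      then show "(a, b) \<in> ?C" using c by simp
    qed
  next
    assume complete: ?complete
    have "T \<subseteq> f ` ?C"
    proof
      fix x assume "x \<in> T"
      then obtain a \<beta> where x: "x = (a, \<beta>)" and a: "a \<in> pair_tuples d n"
        and \<beta>: "\<beta> \<in> indices d n" "Q \<beta> = Q (corner d a {})"
        by (auto simp: T_def)
      obtain b where b: "b \<in> pair_tuples d n" "corner d b {} = \<beta>" "simplex_agreement d Q a b"
        using simplex_agreement_exists[OF Q a \<beta>] .
      then have "(a, b) \<in> ?C" using complete a by blast
      moreover have "f (a, b) = x" using b by (simp add: f_def x)
      ultimately show "x \<in> f ` ?C" by (metis imageI)
    qed
    with sub show "f ` ?C = T" by blast
  qed
  finally show ?thesis by (simp add: cardT)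
qed

section \<open>Completion of simplices versus the quadrangle criterion on planes\<close>

lemma complete_imp_quadrangle_planes:
  assumes complete: "\<forall>a\<in>pair_tuples d n. \<forall>b\<in>pair_tuples d n.
       simplex_agreement d Q a b \<longrightarrow> (a, b) \<in> cuboctahedra d n Q"
    and ij: "i < j" "j < d" and \<alpha>: "\<alpha> \<in> indices d n" and \<beta>: "\<beta> \<in> indices d n"
  shows "quadrangle n (plane Q \<alpha> i j) (plane Q \<beta> i j)"
  unfolding quadrangle_def
proof (intro allI impI)
  fix r c s t r' c' s' t'
  assume less: "r < n" "c < n" "s < n" "t < n" "r' < n" "c' < n" "s' < n" "t' < n"
    and eq: "plane Q \<alpha> i j r c = plane Q \<beta> i j r' c'" "plane Q \<alpha> i j s c = plane Q \<beta> i j s' c'"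
      "plane Q \<alpha> i j r t = plane Q \<beta> i j r' t'"
  \<comment> \<open>A cuboctahedron that is degenerate in all directions other than \<open>i\<close> and \<open>j\<close>.\<close>
  define A where "A \<gamma> r c s t =
      (\<lambda>k\<in>{..<d}. if k = i then (r, s) else if k = j then (c, t) else (\<gamma> k, \<gamma> k))"
    for \<gamma> :: "nat \<Rightarrow> nat" and r c s t :: nat
  have A: "A \<gamma> r c s t \<in> pair_tuples d n"
    if "\<gamma> \<in> indices d n" "r < n" "c < n" "s < n" "t < n" for \<gamma> r c s t
    using that indices_less[OF that(1)] by (auto simp: A_def pair_tuples_def)
  have corner_A: "Q (corner d (A \<gamma> r c s t) J) =
      plane Q \<gamma> i j (if i \<in> J then s else r) (if j \<in> J then t else c)"
    if "\<gamma> \<in> indices d n" for \<gamma> r c s t J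
  proof -
    have "corner d (A \<gamma> r c s t) J =
        \<gamma>(i := if i \<in> J then s else r, j := if j \<in> J then t else c)"
      using that ij by (auto simp: corner_def A_def fun_eq_iff indices_def PiE_iff extensional_def)
    then show ?thesis by (simp add: plane_def)
  qed
  \<comment> \<open>In a degenerate direction the neighbouring corner equals the base corner, so the
    three given equations cover all \<open>d + 1\<close> conditions.\<close>
  have "simplex_agreement d Q (A \<alpha> r c s t) (A \<beta> r' c' s' t')"
    using eq ij by (auto simp: simplex_agreement_def corner_A \<alpha> \<beta>)
  then have "(A \<alpha> r c s t, A \<beta> r' c' s' t') \<in> cuboctahedra d n Q"
    using complete A \<alpha> \<beta> less by blast
  moreover have "{i, j} \<subseteq> {..<d}" using ij by auto
  ultimately have "Q (corner d (A \<alpha> r c s t) {i, j}) = Q (corner d (A \<beta> r' c' s' t') {i, j})"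
    unfolding cuboctahedra_def by blast
  then show "plane Q \<alpha> i j s t = plane Q \<beta> i j s' t'"
    by (simp add: corner_A \<alpha> \<beta>)
qed

text \<open>Induction along strict inclusion of \<open>J\<close>. Removing two directions
  \<open>i\<close> and \<open>j\<close> from \<open>J\<close> leaves \<open>K\<close>; the corners
  for \<open>K\<close>, \<open>K\<close> with \<open>i\<close>, \<open>K\<close> with
  \<open>j\<close>, and \<open>J\<close> form a quadrangle in a plane of direction
  \<open>(i, j)\<close>, and the first three are settled by induction.\<close>

lemma quadrangle_planes_imp_complete:
  assumes quad: "\<And>i j \<alpha> \<beta>. i < j \<Longrightarrow> j < d \<Longrightarrow> \<alpha> \<in> indices d n \<Longrightarrow> \<beta> \<in> indices d n \<Longrightarrow>
       quadrangle n (plane Q \<alpha> i j) (plane Q \<beta> i j)"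
    and a: "a \<in> pair_tuples d n" and b: "b \<in> pair_tuples d n" and ab: "simplex_agreement d Q a b"
  shows "(a, b) \<in> cuboctahedra d n Q"
proof -
  have "Q (corner d a J) = Q (corner d b J)" if "J \<subseteq> {..<d}" for J
    using finite_subset[OF that finite_lessThan] that
  proof (induction J rule: finite_psubset_induct)
    case (psubset J)
    show ?case
    proof (cases "\<exists>i\<in>J. \<exists>j\<in>J. i < j")
      \<comment> \<open>At most one direction is chosen, which is the case covered by simplex
        agreement itself.\<close>
      case False
      then have "\<And>i j. i \<in> J \<Longrightarrow> j \<in> J \<Longrightarrow> i = j" by (meson linorder_neqE_nat)
      then have "J = {} \<or> (\<exists>i. J = {i})" by blast
      then show ?thesis using ab psubset.prems by (auto simp: simplex_agreement_def)
    next
      case True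
      then obtain i j where ij: "i \<in> J" "j \<in> J" "i < j" by blast
      define K where "K = J - {i, j}"
      have d: "i < d" "j < d" using ij psubset.prems by auto
      have J: "J = insert j (insert i K)" using ij by (auto simp: K_def)
      have K: "i \<notin> K" "j \<notin> K" by (auto simp: K_def)
      have IH: "Q (corner d a I) = Q (corner d b I)" if "I \<subset> J" for I
        using psubset.IH[OF that] psubset.prems that by blast
      \<comment> \<open>The corner for \<open>K\<close> supplies the fixed coordinates of the plane.
        As \<open>K\<close> avoids \<open>i\<close> and \<open>j\<close>, this corner has first
        entries there, and overwriting them yields the other three. The identities are used for both
        \<open>e = a\<close> and \<open>e = b\<close>.\<close>
      have pl: "plane Q (corner d e K) i j (fst (e i)) (fst (e j)) = Q (corner d e K)"
        "plane Q (corner d e K) i j (snd (e i)) (fst (e j)) = Q (corner d e (insert i K))"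
        "plane Q (corner d e K) i j (fst (e i)) (snd (e j)) = Q (corner d e (insert j K))"
        "plane Q (corner d e K) i j (snd (e i)) (snd (e j)) = Q (corner d e J)" for e
        unfolding plane_def using d K ij
        by (auto intro!: arg_cong[where f = Q] simp: J corner_def fun_eq_iff)
      have "plane Q (corner d a K) i j (snd (a i)) (snd (a j)) =
          plane Q (corner d b K) i j (snd (b i)) (snd (b j))"
      proof (rule quadrangleD[OF quad[OF ij(3) d(2) corner_in_indices[OF a] corner_in_indices[OF b]]])
        show "plane Q (corner d a K) i j (fst (a i)) (fst (a j)) =
          plane Q (corner d b K) i j (fst (b i)) (fst (b j))"
          unfolding pl using J K by (intro IH) auto
        show "plane Q (corner d a K) i j (snd (a i)) (fst (a j)) =
          plane Q (corner d b K) i j (snd (b i)) (fst (b j))"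
          unfolding pl using J K ij by (intro IH) auto
        show "plane Q (corner d a K) i j (fst (a i)) (snd (a j)) =
          plane Q (corner d b K) i j (fst (b i)) (snd (b j))"
          unfolding pl using J K ij by (intro IH) auto
      qed (simp_all add: pair_tuples_less[OF a] pair_tuples_less[OF b] d)
      then show ?thesis unfolding pl .
    qed
  qed
  then show ?thesis using a b by (simp add: cuboctahedra_def)
qed

theorem theorem3:
  fixes d n :: nat and Q :: "(nat \<Rightarrow> nat) \<Rightarrow> nat"
  assumes "d \<ge> 1" and "n \<ge> 1" and "latin_hypercube d n Q"
  shows "card (cuboctahedra d n Q) = n ^ (3 * d - 1) \<longleftrightarrow>
    (\<forall>i j. i < j \<and> j < d \<longrightarrow>
      (\<exists>L. latin_square n L \<and> isotopic_to_Cayley_table n L \<and>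
        (\<forall>\<alpha>\<in>indices d n. principally_isotopic n (plane Q \<alpha> i j) L)))"
proof -
  note Q = assms(3)
  have n: "0 < n" using assms(2) by simp
  show ?thesis
    unfolding card_cuboctahedra_eq_iff[OF Q assms(1)]
  proof (intro iffI allI impI)
    fix i j
    assume complete: "\<forall>a\<in>pair_tuples d n. \<forall>b\<in>pair_tuples d n.
       simplex_agreement d Q a b \<longrightarrow> (a, b) \<in> cuboctahedra d n Q"
      and "i < j \<and> j < d"
    then have ij: "i < j" "j < d" by auto
    \<comment> \<open>The plane through the zero index, which exists because \<open>n\<close> is
      positive, serves as the square \<open>L\<close> for direction \<open>(i, j)\<close>.\<close>
    define \<alpha>0 where "\<alpha>0 = (\<lambda>k\<in>{..<d}. 0 :: nat)"
    have \<alpha>0: "\<alpha>0 \<in> indices d n" using n by (auto simp: \<alpha>0_def indices_def)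
    note quad = complete_imp_quadrangle_planes[OF complete ij]
    note sq = latin_square_plane[OF Q _ ij]
    show "\<exists>L. latin_square n L \<and> isotopic_to_Cayley_table n L \<and>
        (\<forall>\<alpha>\<in>indices d n. principally_isotopic n (plane Q \<alpha> i j) L)"
      using sq[OF \<alpha>0] quadrangle_imp_isotopic_to_Cayley_table[OF sq[OF \<alpha>0] n quad[OF \<alpha>0 \<alpha>0]]
        quadrangle_imp_principally_isotopic[OF sq sq[OF \<alpha>0] n quad[OF _ \<alpha>0]] by blast
  next
    assume *: "\<forall>i j. i < j \<and> j < d \<longrightarrow>
      (\<exists>L. latin_square n L \<and> isotopic_to_Cayley_table n L \<and>
        (\<forall>\<alpha>\<in>indices d n. principally_isotopic n (plane Q \<alpha> i j) L))"
    \<comment> \<open>Both planes are compared through the one square \<open>L\<close> that belongs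
      to the direction \<open>(i, j)\<close>.\<close>
    have "quadrangle n (plane Q \<alpha> i j) (plane Q \<beta> i j)"
      if "i < j" "j < d" "\<alpha> \<in> indices d n" "\<beta> \<in> indices d n" for i j \<alpha> \<beta>
      using * that isotopic_to_Cayley_table_imp_quadrangle quadrangle_principally_isotopic by metis
    then show "\<forall>a\<in>pair_tuples d n. \<forall>b\<in>pair_tuples d n.
       simplex_agreement d Q a b \<longrightarrow> (a, b) \<in> cuboctahedra d n Q"
      using quadrangle_planes_imp_complete by blast
  qed
qed

end
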